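(* Let $k\ge 2$ be an integer and let $V(k,0)(0)=\{v\in V(k,0)\mid h(0)v=0\}$. Then $V(k,0)(0)$ is a vertex operator subalgebra of $V(k,0)$, and as a vertex operator algebra it is generated by the two vectors $h(-1)\mathbb{1}$ and $f(-2)e(-1)\mathbb{1}$, i.e. the smallest subspace of $V(k,0)(0)$ containing $\mathbb{1}$, $h(-1)\mathbb{1}$ and $f(-2)e(-1)\mathbb{1}$ and closed under all products $u_n v$ ($n\in\mathbb{Z}$) is $V(k,0)(0)$ itself.
   Context: Let $\{h,e,f\}$ be the standard basis of $sl_2$ with $[h,e]=2e$, $[h,f]=-2f$, $[e,f]=h$, and $\langle\cdot,\cdot\rangle$ the normalized invariant form with $\langle h,h\rangle=2$, $\langle e,f\rangle=1$, all other pairings of basis elements zero. Let $\widehat{sl}_2=sl_2\otimes\mathbb{C}[t,t^{-1}]\oplus\mathbb{C}C$ be the affine Lie algebra, with $a(n)$ denoting the action of $a\otimes t^n$, so $[a(m),b(n)]=[a,b](m+n)+m\langle a,b\rangle\delta_{m+n,0}k$ on a level $k$ module. $V(k,0)=\mathrm{Ind}_{sl_2\otimes\mathbb{C}[t]\oplus\mathbb{C}C}^{\widehat{sl}_2}\mathbb{C}$ is the induced (Weyl) module in which $sl_2\otimes\mathbb{C}[t]$ acts as $0$ and $C$ acts as $k$ on $\mathbb{1}=1$. It is a vertex operator algebra with vacuum $\mathbb{1}$, with $Y(a(-1)\mathbb{1},z)=\sum_{n\in\mathbb{Z}}a(n)z^{-n-1}$ for $a\in sl_2$, and Virasoro vector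 $\omega_{\mathrm{aff}}=\frac{1}{2(k+2)}\big(\frac12 h(-1)^2\mathbb{1}+e(-1)f(-1)\mathbb{1}+f(-1)e(-1)\mathbb{1}\big)$. For $u\in V(k,0)$ write $Y(u,z)=\sum_n u_n z^{-n-1}$. *)

theory Defs
  imports Complex_Main
begin

datatype sl2b = H | E | F

text \<open>Structure constants: [a,b] = sum over c of brk a b c times c.\<close>
fun brk :: "sl2b \<Rightarrow> sl2b \<Rightarrow> sl2b \<Rightarrow> complex" where
  "brk H E c = (if c = E then 2 else 0)"
| "brk E H c = (if c = E then -2 else 0)"
| "brk H F c = (if c = F then -2 else 0)"
| "brk F H c = (if c = F then 2 else 0)"
| "brk E F c = (if c = H then 1 else 0)"
| "brk F E c = (if c = H then -1 else 0)"
| "brk _ _ c = 0"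

fun form :: "sl2b \<Rightarrow> sl2b \<Rightarrow> complex" where
  "form H H = 2"
| "form E F = 1"
| "form F E = 1"
| "form _ _ = 0"

text \<open>Level k representation of the affine algebra: X a n is the action of a(n).\<close>
definition affine_rep ::
  "(complex \<Rightarrow> 'v::ab_group_add \<Rightarrow> 'v) \<Rightarrow> complex \<Rightarrow> (sl2b \<Rightarrow> int \<Rightarrow> 'v \<Rightarrow> 'v) \<Rightarrow> bool" where
  "affine_rep sc k X \<longleftrightarrow>
     (\<forall>a n. module_hom sc sc (X a n)) \<and>
     (\<forall>a b m n v. X a m (X b n v) - X b n (X a m v) =
         (\<Sum>c\<in>UNIV. sc (brk a b c) (X c (m + n) v))
         + sc (of_int m * form a b * (if m + n = 0 then 1 else 0) * k) v)"

fun idx :: "sl2b \<Rightarrow> nat" where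
  "idx H = 0" | "idx E = 1" | "idx F = 2"

definition pbw_key :: "sl2b \<times> nat \<Rightarrow> nat" where
  "pbw_key p = 3 * snd p + idx (fst p)"

definition pbw_monos :: "(sl2b \<times> nat) list set" where
  "pbw_monos = {ps. (\<forall>p\<in>set ps. snd p \<ge> 1) \<and> sorted_wrt (\<lambda>p q. pbw_key p \<le> pbw_key q) ps}"

fun pbw_vec :: "(sl2b \<Rightarrow> int \<Rightarrow> 'v \<Rightarrow> 'v) \<Rightarrow> 'v \<Rightarrow> (sl2b \<times> nat) list \<Rightarrow> 'v" where
  "pbw_vec X vac [] = vac"
| "pbw_vec X vac (p # ps) = X (fst p) (- int (snd p)) (pbw_vec X vac ps)"

text \<open>(V, X, vac) is (isomorphic to) the induced level-k module V(k,0):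
  vac is annihilated by sl_2 \<otimes> C[t] and the ordered PBW monomials applied to vac
  form a basis of V.\<close>
definition weyl_module ::
  "(complex \<Rightarrow> 'v::ab_group_add \<Rightarrow> 'v) \<Rightarrow> complex \<Rightarrow> (sl2b \<Rightarrow> int \<Rightarrow> 'v \<Rightarrow> 'v) \<Rightarrow> 'v \<Rightarrow> bool" where
  "weyl_module sc k X vac \<longleftrightarrow>
     vector_space sc \<and> affine_rep sc k X \<and>
     (\<forall>a n. n \<ge> 0 \<longrightarrow> X a n vac = 0) \<and>
     inj_on (pbw_vec X vac) pbw_monos \<and>
     module.independent sc (pbw_vec X vac ` pbw_monos) \<and>
     module.span sc (pbw_vec X vac ` pbw_monos) = UNIV"

text \<open>Vertex algebra axioms; Y u n v is the product u_n v.  The Borcherds identity is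
  stated with partial sums over i < M that agree for all sufficiently large M
  (the sums are finite by truncation).\<close>
definition vertex_algebra ::
  "(complex \<Rightarrow> 'v::ab_group_add \<Rightarrow> 'v) \<Rightarrow> ('v \<Rightarrow> int \<Rightarrow> 'v \<Rightarrow> 'v) \<Rightarrow> 'v \<Rightarrow> bool" where
  "vertex_algebra sc Y vac \<longleftrightarrow>
     vector_space sc \<and>
     (\<forall>u n. module_hom sc sc (Y u n)) \<and>
     (\<forall>n w. module_hom sc sc (\<lambda>u. Y u n w)) \<and>
     (\<forall>u v. \<exists>N. \<forall>n\<ge>N. Y u n v = 0) \<and>
     (\<forall>n v. Y vac n v = (if n = -1 then v else 0)) \<and>
     (\<forall>u. Y u (-1) vac = u) \<and>
     (\<forall>u n. n \<ge> 0 \<longrightarrow> Y u n vac = 0) \<and>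
     (\<forall>u v w m n r. \<exists>N. \<forall>M\<ge>N.
        (\<Sum>i<M. sc (of_int m gchoose i) (Y (Y u (r + int i) v) (m + n - int i) w)) =
        (\<Sum>i<M. sc ((-1) ^ i * (of_int r gchoose i))
             (Y u (m + r - int i) (Y v (n + int i) w)
              - sc ((-1) powi r) (Y v (n + r - int i) (Y u (m + int i) w)))))"

definition affine_voa ::
  "(complex \<Rightarrow> 'v::ab_group_add \<Rightarrow> 'v) \<Rightarrow> complex \<Rightarrow> (sl2b \<Rightarrow> int \<Rightarrow> 'v \<Rightarrow> 'v) \<Rightarrow> 'v
     \<Rightarrow> ('v \<Rightarrow> int \<Rightarrow> 'v \<Rightarrow> 'v) \<Rightarrow> bool" where
  "affine_voa sc k X vac Y \<longleftrightarrow>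
     weyl_module sc k X vac \<and> vertex_algebra sc Y vac \<and>
     (\<forall>a n. Y (X a (-1) vac) n = X a n)"

definition omega_aff ::
  "(complex \<Rightarrow> 'v::ab_group_add \<Rightarrow> 'v) \<Rightarrow> complex \<Rightarrow> (sl2b \<Rightarrow> int \<Rightarrow> 'v \<Rightarrow> 'v) \<Rightarrow> 'v \<Rightarrow> 'v" where
  "omega_aff sc k X vac = sc (1 / (2 * (k + 2)))
     (sc (1/2) (X H (-1) (X H (-1) vac)) + X E (-1) (X F (-1) vac) + X F (-1) (X E (-1) vac))"

inductive_set vgen ::
  "(complex \<Rightarrow> 'v::ab_group_add \<Rightarrow> 'v) \<Rightarrow> ('v \<Rightarrow> int \<Rightarrow> 'v \<Rightarrow> 'v) \<Rightarrow> 'v set \<Rightarrow> 'v set"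
  for sc Y S where
  base: "x \<in> S \<Longrightarrow> x \<in> vgen sc Y S"
| zero: "0 \<in> vgen sc Y S"
| add: "x \<in> vgen sc Y S \<Longrightarrow> y \<in> vgen sc Y S \<Longrightarrow> x + y \<in> vgen sc Y S"
| scale: "x \<in> vgen sc Y S \<Longrightarrow> sc c x \<in> vgen sc Y S"
| prod: "u \<in> vgen sc Y S \<Longrightarrow> v \<in> vgen sc Y S \<Longrightarrow> Y u n v \<in> vgen sc Y S"

end

theory Submission
  imports Defs
begin

text \<open>Let U be the subalgebra generated by h(-1)1 and W = f(-2)e(-1)1. It is stable under all h(n)
  and under the translation operator D u = u_{-2} 1. First, h(1)W = -2 f(-1)e(-1)1, and modulo the
  lower terms that are already in U
  \[ W_1 f(-m)e(-1)1 = ((k+1)m+1)(m+2) f(-m-1)e(-1)1, \]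
  whose coefficient does not vanish for k \<ge> 0; induction on m gives every f(-m)e(-1)1, and applying D
  gives every f(-m)e(-n)1. Next, filter the module by the number of creation operators in a word.
  Creation operators commute up to shorter words, and (f(-m)e(-n)1)_{-1} acts as f(-m)e(-n) up to
  shorter words, so by induction on the length every word of h(0)-weight zero lies in U. By the PBW
  basis, such words span the kernel of h(0).\<close>

section \<open>Binomial coefficients and the charge of words\<close>

lemma UNIV_sl2b: "(UNIV :: sl2b set) = {H, E, F}"
  using sl2b.exhaust by auto

text \<open>These are the coefficients of the iterate formula at r = -2, the exponent for the modes
  of f(-2)e(-1)1.\<close>

lemma gchoose_minus_two: "(-1) ^ i * ((- 2 :: complex) gchoose i) = of_nat (Suc i)"
proof -
  have "(1 + of_nat i :: complex) gchoose i = of_nat (Suc i choose i)"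
    by (subst binomial_gbinomial) simp
  then show ?thesis
    by (simp add: gbinomial_minus[of 2 i] algebra_simps flip: power_mult_distrib power_add mult.assoc)
qed

text \<open>Half the eigenvalue of ad h on the basis vector.\<close>

fun chg :: "sl2b \<Rightarrow> int" where
  "chg H = 0" | "chg E = 1" | "chg F = -1"

definition charge :: "(sl2b \<times> nat) list \<Rightarrow> int" where
  "charge ps = (\<Sum>p\<leftarrow>ps. chg (fst p))"

lemma charge_simps [simp]: "charge [] = 0" "charge (p # ps) = chg (fst p) + charge ps"
  by (simp_all add: charge_def)

lemma charge_remove1: "p \<in> set ps \<Longrightarrow> charge (remove1 p ps) = charge ps - chg (fst p)"
  by (induction ps) auto

lemma brk_chg: "brk a b c \<noteq> 0 \<Longrightarrow> chg c = chg a + chg b"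
  by (cases a; cases b; cases c) auto

lemma form_chg: "form a b \<noteq> 0 \<Longrightarrow> chg a + chg b = 0"
  by (cases a; cases b) auto

lemma charge_pos_E: "charge ps > 0 \<Longrightarrow> \<exists>n. (E, n) \<in> set ps"
proof (induction ps)
  case (Cons p ps)
  then show ?case by (cases p; cases "fst p") auto
qed simp

lemma charge_neg_F: "charge ps < 0 \<Longrightarrow> \<exists>n. (F, n) \<in> set ps"
proof (induction ps)
  case (Cons p ps)
  then show ?case by (cases p; cases "fst p") auto
qed simp

text \<open>A letter other than h has charge 1 or -1, so deleting it leaves a word of the opposite
  charge, which must contain the opposite letter. This supplies the pair f(-m), e(-n) that the final
  induction splits off.\<close>

lemma charge_zero_cases:
  assumes "charge ps = 0"
  obtains "fst ` set ps \<subseteq> {H}" | m n where "(F, m) \<in> set ps" "(E, n) \<in> set ps"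
proof (cases "fst ` set ps \<subseteq> {H}")
  case False
  then obtain a n where p: "(a, n) \<in> set ps" "a \<noteq> H" by (auto simp: image_subset_iff)
  then have ch: "charge (remove1 (a, n) ps) = - chg a"
    using assms by (simp add: charge_remove1)
  show thesis
  proof (cases a)
    case E
    then obtain m where "(F, m) \<in> set (remove1 (a, n) ps)"
      using ch charge_neg_F[of "remove1 (a, n) ps"] by auto
    then show thesis using that(2) p E notin_set_remove1 by metis
  next
    case F
    then obtain m where "(E, m) \<in> set (remove1 (a, n) ps)"
      using ch charge_pos_E[of "remove1 (a, n) ps"] by auto
    then show thesis using that(2) p F notin_set_remove1 by metis
  qed (use p in simp)
qed (use that in blast)

section \<open>The affine vertex algebra and its mode commutators\<close>

locale affine_vertex_algebra =
  fixes sc :: "complex \<Rightarrow> 'v::ab_group_add \<Rightarrow> 'v"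
    and k :: complex
    and X :: "sl2b \<Rightarrow> int \<Rightarrow> 'v \<Rightarrow> 'v"
    and vac :: 'v
    and Y :: "'v \<Rightarrow> int \<Rightarrow> 'v \<Rightarrow> 'v"
  assumes affine_voa: "affine_voa sc k X vac Y"
begin

sublocale vector_space sc
  using affine_voa by (simp add: affine_voa_def weyl_module_def)

lemma X_hom: "module_hom sc sc (X a n)"
  and X_comm: "X a m (X b n v) - X b n (X a m v) =
         (\<Sum>c\<in>UNIV. sc (brk a b c) (X c (m + n) v))
         + sc (of_int m * form a b * (if m + n = 0 then 1 else 0) * k) v"
  using affine_voa by (simp_all add: affine_voa_def weyl_module_def affine_rep_def)

lemma X_vac [simp]: "n \<ge> 0 \<Longrightarrow> X a n vac = 0"
  using affine_voa by (simp add: affine_voa_def weyl_module_def)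

lemma Y_X: "Y (X a (-1) vac) n = X a n"
  using affine_voa by (simp add: affine_voa_def)

lemma vertex: "vertex_algebra sc Y vac"
  using affine_voa by (simp add: affine_voa_def)

lemma Y_vac: "Y vac n v = (if n = -1 then v else 0)"
  and Y_creation: "Y u (-1) vac = u"
  and Y_annihilation: "n \<ge> 0 \<Longrightarrow> Y u n vac = 0"
  and Y_hom: "module_hom sc sc (Y u n)"
  and Y_hom_left: "module_hom sc sc (\<lambda>u. Y u n w)"
  using vertex by (simp_all add: vertex_algebra_def)

lemma X_linear [simp]:
  "X a n (v + w) = X a n v + X a n w" "X a n (v - w) = X a n v - X a n w"
  "X a n (sc c v) = sc c (X a n v)" "X a n 0 = 0" "X a n (- v) = - X a n v"
  using X_hom[of a n] by (auto simp: module_hom.add module_hom.diff module_hom.scale module_hom.zero module_hom.neg)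

lemma Y_linear:
  "Y u n (v + w) = Y u n v + Y u n w" "Y u n (v - w) = Y u n v - Y u n w"
  "Y u n (sc c v) = sc c (Y u n v)" "Y u n 0 = 0"
  using Y_hom[of u n] by (auto simp: module_hom.add module_hom.diff module_hom.scale module_hom.zero)

lemma Y_zero_left: "Y 0 n w = 0"
  using module_hom.zero[OF Y_hom_left] .

lemma X_swap: "X a m (X b n v) = X b n (X a m v) +
         (\<Sum>c\<in>UNIV. sc (brk a b c) (X c (m + n) v))
         + sc (of_int m * form a b * (if m + n = 0 then 1 else 0) * k) v"
  using X_comm[of a m b n v] by (simp add: algebra_simps)

lemma E_F: "X E m (X F n v) = X F n (X E m v) + X H (m + n) v
    + sc (if m + n = 0 then of_int m * k else 0) v"
  and H_E: "X H m (X E n v) = X E n (X H m v) + sc 2 (X E (m + n) v)"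
  and H_F: "X H m (X F n v) = X F n (X H m v) - sc 2 (X F (m + n) v)"
  and E_E: "X E m (X E n v) = X E n (X E m v)"
  and F_F: "X F m (X F n v) = X F n (X F m v)"
  and H0_H: "X H 0 (X H n v) = X H n (X H 0 v)"
  using X_swap[of E m F n v] X_swap[of H m E n v] X_swap[of H m F n v]
    X_swap[of E m E n v] X_swap[of F m F n v] X_swap[of H 0 H n v]
  by (simp_all add: UNIV_sl2b scale_minus_left)

section \<open>The iterate formula and its consequences\<close>

text \<open>This is the Borcherds identity at m = 0: the binomials 0 choose i leave only the term i
  = 0 on the left.\<close>

lemma iterate_formula:
  "\<exists>N. \<forall>M\<ge>N. Y (Y u r v) n w = (\<Sum>i<M. sc ((-1) ^ i * (of_int r gchoose i))
             (Y u (r - int i) (Y v (n + int i) w)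
              - sc ((-1) powi r) (Y v (n + r - int i) (Y u (int i) w))))"
proof -
  have "\<exists>N. \<forall>M\<ge>N.
        (\<Sum>i<M. sc (of_int 0 gchoose i) (Y (Y u (r + int i) v) (0 + n - int i) w)) =
        (\<Sum>i<M. sc ((-1) ^ i * (of_int r gchoose i))
             (Y u (0 + r - int i) (Y v (n + int i) w)
              - sc ((-1) powi r) (Y v (n + r - int i) (Y u (0 + int i) w))))"
    using vertex unfolding vertex_algebra_def by blast
  then obtain N where N: "\<And>M. M \<ge> N \<Longrightarrow>
        (\<Sum>i<M. sc (of_int 0 gchoose i) (Y (Y u (r + int i) v) (0 + n - int i) w)) =
        (\<Sum>i<M. sc ((-1) ^ i * (of_int r gchoose i))
             (Y u (0 + r - int i) (Y v (n + int i) w)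
              - sc ((-1) powi r) (Y v (n + r - int i) (Y u (0 + int i) w))))"
    by blast
  \<comment> \<open>The surviving term i = 0 is present only when the range is nonempty, hence
    \<open>Suc M\<close>.\<close>
  have "(\<Sum>i<Suc M. sc (of_int 0 gchoose i) (Y (Y u (r + int i) v) (0 + n - int i) w)) = Y (Y u r v) n w" for M
    by (subst sum.lessThan_Suc_shift) (simp add: gbinomial_0_left)
  then have "Y (Y u r v) n w = (\<Sum>i<Suc M. sc ((-1) ^ i * (of_int r gchoose i))
             (Y u (r - int i) (Y v (n + int i) w)
              - sc ((-1) powi r) (Y v (n + r - int i) (Y u (int i) w))))" if "M \<ge> N" for M
    using N[of "Suc M"] that by (simp only: add_0 le_SucI)
  note Suc_M = this
  show ?thesis
  proof (intro exI allI impI)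
    fix M assume "M \<ge> Suc N"
    then obtain M' where M': "M = Suc M'" "M' \<ge> N" using Suc_le_D by blast
    show "Y (Y u r v) n w = (\<Sum>i<M. sc ((-1) ^ i * (of_int r gchoose i))
             (Y u (r - int i) (Y v (n + int i) w)
              - sc ((-1) powi r) (Y v (n + r - int i) (Y u (int i) w))))"
      unfolding M'(1) by (rule Suc_M[OF M'(2)])
  qed
qed

text \<open>At r = 0 with first vector h(-1)1 only i = 0 contributes, so the iterate formula becomes
  the commutator of h(0) with the mode of u.\<close>

lemma H0_derivation: "X H 0 (Y u n w) = Y (X H 0 u) n w + Y u n (X H 0 w)"
proof -
  obtain N where N: "\<forall>M\<ge>N. Y (Y (X H (-1) vac) 0 u) n w = (\<Sum>i<M. sc ((-1) ^ i * (of_int 0 gchoose i))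
             (Y (X H (-1) vac) (0 - int i) (Y u (n + int i) w)
              - sc ((-1) powi 0) (Y u (n + 0 - int i) (Y (X H (-1) vac) (int i) w))))"
    using iterate_formula by blast
  have "Y (X H 0 u) n w = X H 0 (Y u n w) - Y u n (X H 0 w)"
    using N[rule_format, of "Suc N"]
    by (simp add: Y_X sum.lessThan_Suc_shift gbinomial_0_left del: sum.lessThan_Suc)
  then show ?thesis by simp
qed

abbreviation D :: "'v \<Rightarrow> 'v" where "D v \<equiv> Y v (-2) vac"

text \<open>On the vacuum every mode a(i) with i \<ge> 0 vanishes, and so does v_{i-2} for i \<ge>
  2. Only i = 0 and i = 1 survive, giving [D, a(r)] = -r a(r-1).\<close>

lemma D_X: "D (X a r v) = X a r (D v) - sc (of_int r) (X a (r - 1) v)"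
proof -
  let ?u = "X a (-1) vac"
  let ?t = "\<lambda>i. sc ((-1) ^ i * (of_int r gchoose i))
             (Y ?u (r - int i) (Y v (-2 + int i) vac)
              - sc ((-1) powi r) (Y v (-2 + r - int i) (Y ?u (int i) vac)))"
  obtain N where N: "\<forall>M\<ge>N. Y (Y ?u r v) (-2) vac = (\<Sum>i<M. ?t i)"
    using iterate_formula by blast
  have z: "?t (i + 2) = 0" for i
    by (simp add: Y_X Y_linear Y_annihilation)
  have "Y (Y ?u r v) (-2) vac = (\<Sum>i<Suc (Suc N). ?t i)"
    by (rule N[rule_format]) simp
  also have "\<dots> = ?t 0 + ?t 1 + (\<Sum>i<N. ?t (i + 2))"
    by (simp only: sum.lessThan_Suc_shift) simp
  also have "\<dots> = ?t 0 + ?t 1"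
    by (simp only: z sum.neutral_const add_0_right)
  finally show ?thesis
    by (simp add: Y_X Y_linear Y_creation scale_minus_left)
qed

text \<open>The field of a(-n)1 is the (n-1)-st derivative of a(z) divided by (n-1)!, so its modes
  are multiples of modes of a. The multiple vanishes for 0 \<le> q < n-1, exactly where a
  nonnegative mode of the field would otherwise give a creation operator.\<close>

lemma Y_creation_mode:
  assumes "n \<ge> 1"
  shows "\<exists>c. (Y (X a (- int n) vac) q w = sc c (X a (q - int n + 1) w)) \<and> (q = -1 \<longrightarrow> c = 1)
      \<and> (0 \<le> q \<and> q < int n - 1 \<longrightarrow> c = 0)"
proof -
  let ?u = "X a (-1) vac"
  let ?t = "\<lambda>i. sc ((-1) ^ i * (of_int (- int n) gchoose i))
             (Y ?u (- int n - int i) (Y vac (q + int i) w)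
              - sc ((-1) powi (- int n)) (Y vac (q + (- int n) - int i) (Y ?u (int i) w)))"
  obtain N where N: "\<forall>M\<ge>N. Y (Y ?u (- int n) vac) q w = (\<Sum>i<M. ?t i)"
    using iterate_formula by blast
  \<comment> \<open>Large enough to contain the one index j that survives in the cases
    below.\<close>
  define M where "M = N + nat (\<bar>q\<bar>) + n + 1"
  have eq: "Y (X a (- int n) vac) q w = (\<Sum>i<M. ?t i)"
    using N[rule_format, of M] by (simp add: M_def Y_X del: sum.lessThan_Suc)
  \<comment> \<open>The vacuum has only the mode -1. It is hit in the first product when q < 0, in
    the second when q \<ge> n-1, and in neither for q in between.\<close>
  consider "q < 0" | "0 \<le> q" "q < int n - 1" | "q \<ge> 0" "q \<ge> int n - 1" by linarith
  then show ?thesis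
  proof cases
    case 1
    define j where "j = nat (-1 - q)"
    have jM: "j < M" using 1 by (simp add: M_def j_def)
    have e: "q + int i = -1 \<longleftrightarrow> i = j" "- int n - int j = q - int n + 1" for i
      using 1 by (auto simp: j_def)
    have "?t i = (if i = j then sc ((-1) ^ j * (of_int (- int n) gchoose j)) (X a (q - int n + 1) w) else 0)" for i
      using 1 e(1)[of i] assms by (auto simp: Y_X Y_vac e(2))
    then have "(\<Sum>i<M. ?t i) = sc ((-1) ^ j * (of_int (- int n) gchoose j)) (X a (q - int n + 1) w)"
      using jM by simp
    moreover have "q = -1 \<longrightarrow> (-1) ^ j * ((of_int (- int n) :: complex) gchoose j) = 1"
      by (simp add: j_def)
    ultimately show ?thesis using eq 1
      by (intro exI[of _ "(-1) ^ j * (of_int (- int n) gchoose j)"]) simp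
  next
    case 2
    then have "?t i = 0" for i by (simp add: Y_X Y_vac)
    then have "(\<Sum>i<M. ?t i) = 0" by (simp only: sum.neutral_const)
    then show ?thesis using eq 2 by (intro exI[of _ 0]) simp
  next
    case 3
    define j where "j = nat (q - int n + 1)"
    have jM: "j < M" unfolding M_def j_def using 3 assms by arith
    have e: "q + (- int n) - int i = -1 \<longleftrightarrow> i = j" "int j = q - int n + 1" for i
      using 3 by (auto simp: j_def)
    have "?t i = (if i = j then sc (- ((-1) ^ j * (of_int (- int n) gchoose j) * (-1) powi (- int n))) (X a (q - int n + 1) w) else 0)" for i
      using 3 e(1)[of i] assms by (auto simp: Y_X Y_vac e(2) mult.commute)
    then have "(\<Sum>i<M. ?t i) = sc (- ((-1) ^ j * (of_int (- int n) gchoose j) * (-1) powi (- int n))) (X a (q - int n + 1) w)"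
      using jM by simp
    then show ?thesis using eq 3
      by (intro exI[of _ "- ((-1) ^ j * (of_int (- int n) gchoose j) * (-1) powi (- int n))"] conjI) simp_all
  qed
qed

section \<open>The length filtration by words of fixed charge\<close>

text \<open>Words need not be PBW-ordered here, so the filtration is stable under creation operators
  without straightening.\<close>
definition Fil :: "nat \<Rightarrow> int \<Rightarrow> 'v set" where
  "Fil l c = span {pbw_vec X vac ps | ps. (\<forall>p\<in>set ps. snd p \<ge> 1) \<and> length ps \<le> l \<and> charge ps = c}"

lemma Fil_subspace [simp]: "subspace (Fil l c)"
  by (simp add: Fil_def)

lemma Fil_mono: "l \<le> l' \<Longrightarrow> Fil l c \<subseteq> Fil l' c"
  unfolding Fil_def by (rule span_mono) auto

lemma Fil_le: "x \<in> Fil l c \<Longrightarrow> l \<le> l' \<Longrightarrow> c = c' \<Longrightarrow> x \<in> Fil l' c'"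
  using Fil_mono by blast

lemma Fil_word: "\<forall>p\<in>set ps. snd p \<ge> 1 \<Longrightarrow> length ps \<le> l \<Longrightarrow> pbw_vec X vac ps \<in> Fil l (charge ps)"
  unfolding Fil_def by (rule span_base) auto

lemma hom_span_mem:
  assumes T: "module_hom sc sc T" and S: "subspace S" and B: "\<And>b. b \<in> B \<Longrightarrow> T b \<in> S"
    and x: "x \<in> span B"
  shows "T x \<in> S"
  using x
proof (induction rule: span_induct_alt)
  case base
  then show ?case using module_hom.zero[OF T] subspace_0[OF S] by simp
next
  case (step c b y)
  then show ?case
    using B subspace_add[OF S] subspace_scale[OF S] module_hom.add[OF T] module_hom.scale[OF T] by simp
qed

lemma X_create_Fil:
  assumes "n < 0" "x \<in> Fil l c"
  shows "X a n x \<in> Fil (Suc l) (c + chg a)"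
  using assms(2) unfolding Fil_def[of l]
proof (rule hom_span_mem[OF X_hom Fil_subspace, rotated])
  fix b assume "b \<in> {pbw_vec X vac ps | ps. (\<forall>p\<in>set ps. snd p \<ge> 1) \<and> length ps \<le> l \<and> charge ps = c}"
  then obtain ps where ps: "b = pbw_vec X vac ps" "\<forall>p\<in>set ps. snd p \<ge> 1" "length ps \<le> l" "charge ps = c"
    by blast
  then show "X a n b \<in> Fil (Suc l) (c + chg a)"
    using Fil_word[of "(a, nat (- n)) # ps" "Suc l"] assms(1) by (simp add: add.commute)
qed

text \<open>The operator is commuted towards the vacuum. At each letter the bracket term puts one
  operator in place of that letter and the central term deletes it, so the length never grows.
  Bracket and form respect charge.\<close>

lemma X_annihilate_word:
  assumes "p \<ge> 0" "\<forall>p\<in>set ps. snd p \<ge> 1"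
  shows "X a p (pbw_vec X vac ps) \<in> Fil (length ps) (charge ps + chg a)"
  using assms
proof (induction ps arbitrary: a p)
  case Nil
  then show ?case by (simp add: subspace_0)
next
  case (Cons bq ps)
  obtain b q where bq: "bq = (b, q)" by fastforce
  let ?v = "pbw_vec X vac ps"
  let ?S = "Fil (Suc (length ps)) (chg b + charge ps + chg a)"
  have v: "?v \<in> Fil (length ps) (charge ps)"
    using Cons by (intro Fil_word) auto
  have q: "q \<ge> 1" using Cons bq by auto
  have 1: "X b (- int q) (X a p ?v) \<in> ?S"
    using X_create_Fil[OF _ Cons.IH[OF Cons.prems(1)], of "- int q" b a] q Cons.prems(2)
    by (simp add: ac_simps)
  have 2: "sc (brk a b c) (X c (p - int q) ?v) \<in> ?S" for c
  proof (cases "brk a b c = 0")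
    case True
    then show ?thesis by (simp add: subspace_0)
  next
    case False
    have "X c (p - int q) ?v \<in> Fil (Suc (length ps)) (charge ps + chg c)"
    proof (cases "p - int q \<ge> 0")
      case True
      then show ?thesis using Cons.IH[OF True, of c] Cons.prems(2)
        by (auto intro: Fil_le)
    next
      case False
      then show ?thesis using X_create_Fil[OF _ v, of "p - int q" c] by simp
    qed
    then show ?thesis using brk_chg[OF False] by (simp add: subspace_scale ac_simps)
  qed
  have 3: "sc (of_int p * form a b * (if p + (- int q) = 0 then 1 else 0) * k) ?v \<in> ?S"
  proof (cases "form a b = 0")
    case True
    then show ?thesis by (simp add: subspace_0)
  next
    case False
    have "?v \<in> ?S" using form_chg[OF False] by (intro Fil_le[OF v]) auto
    then show ?thesis by (simp add: subspace_scale)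
  qed
  show ?case
    using X_swap[of a p b "- int q" ?v] 1 2 3
    by (simp add: bq subspace_add subspace_sum)
qed

lemma X_annihilate_Fil:
  assumes "p \<ge> 0" "x \<in> Fil l c"
  shows "X a p x \<in> Fil l (c + chg a)"
  using assms(2) unfolding Fil_def[of l c]
proof (rule hom_span_mem[OF X_hom Fil_subspace, rotated])
  fix b assume "b \<in> {pbw_vec X vac ps | ps. (\<forall>p\<in>set ps. snd p \<ge> 1) \<and> length ps \<le> l \<and> charge ps = c}"
  then show "X a p b \<in> Fil l (c + chg a)"
    using X_annihilate_word[OF assms(1)] by (auto intro: Fil_le)
qed

text \<open>Two creation operators have a single creation operator as commutator, with no central
  term because both modes are negative. Each exchange therefore costs only words shorter by
  one.\<close>

lemma word_move_front:
  assumes "\<forall>p\<in>set ps. snd p \<ge> 1" "p \<in> set ps"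
  shows "pbw_vec X vac ps - pbw_vec X vac (p # remove1 p ps) \<in> Fil (length ps - 1) (charge ps)"
  using assms
proof (induction ps)
  case Nil
  then show ?case by simp
next
  case (Cons r ps)
  show ?case
  proof (cases "p = r")
    case True
    then show ?thesis by (simp add: subspace_0)
  next
    case False
    then have p: "p \<in> set ps" using Cons by auto
    let ?w = "pbw_vec X vac (remove1 p ps)"
    let ?S = "Fil (length ps) (charge (r # ps))"
    have len: "length ps = Suc (length (remove1 p ps))"
      using p length_pos_if_in_set[OF p] by (simp add: length_remove1)
    have pos: "snd p \<ge> 1" "snd r \<ge> 1" using p Cons.prems by auto
    have w: "?w \<in> Fil (length (remove1 p ps)) (charge ps - chg (fst p))"
      using Fil_word[of "remove1 p ps" "length (remove1 p ps)"] Cons.prems p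
      by (auto simp: charge_remove1 dest: notin_set_remove1)
    have "pbw_vec X vac ps - X (fst p) (- int (snd p)) ?w \<in> Fil (length ps - 1) (charge ps)"
      using Cons p by simp
    from X_create_Fil[OF _ this, of "- int (snd r)" "fst r"]
    have 1: "X (fst r) (- int (snd r)) (pbw_vec X vac ps)
        - X (fst r) (- int (snd r)) (X (fst p) (- int (snd p)) ?w) \<in> ?S"
      using pos len by (simp add: ac_simps)
    have 2: "sc (brk (fst r) (fst p) c) (X c (- int (snd r) + - int (snd p)) ?w) \<in> ?S" for c
    proof (cases "brk (fst r) (fst p) c = 0")
      case True
      then show ?thesis by (simp add: subspace_0)
    next
      case False
      have "X c (- int (snd r) + - int (snd p)) ?w \<in> ?S"
        using X_create_Fil[OF _ w, of "- int (snd r) + - int (snd p)" c] pos len brk_chg[OF False]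
        by (simp add: ac_simps)
      then show ?thesis by (simp add: subspace_scale)
    qed
    have 3: "X (fst r) (- int (snd r)) (X (fst p) (- int (snd p)) ?w)
        - X (fst p) (- int (snd p)) (X (fst r) (- int (snd r)) ?w) \<in> ?S"
      using 2 pos by (simp only: X_comm) (simp add: subspace_sum)
    show ?thesis
      using subspace_add[OF Fil_subspace 1 3] False by simp
  qed
qed

text \<open>The only term of the iterate formula with two creation operators and no annihilation operator
  is the leading one; an annihilation operator does not raise the length.\<close>
lemma quadratic_leading_term:
  assumes mn: "m \<ge> 1" "n \<ge> 1" and w: "w \<in> Fil l 0"
  shows "Y (X F (- int m) (X E (- int n) vac)) (-1) w - X F (- int m) (X E (- int n) w) \<in> Fil (Suc l) 0"
proof -
  let ?u = "X F (-1) vac" and ?v = "X E (- int n) vac"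
  let ?t = "\<lambda>i. sc ((-1) ^ i * (of_int (- int m) gchoose i))
             (Y ?u (- int m - int i) (Y ?v (-1 + int i) w)
              - sc ((-1) powi (- int m)) (Y ?v (-1 + (- int m) - int i) (Y ?u (int i) w)))"
  obtain N where N: "\<forall>M\<ge>N. Y (Y ?u (- int m) ?v) (-1) w = (\<Sum>i<M. ?t i)"
    using iterate_formula by blast
  have neg: "Y ?v (-1 + (- int m) - int i) (Y ?u (int i) w) \<in> Fil (Suc l) 0" for i
  proof -
    obtain c where "Y ?v (-1 + (- int m) - int i) (Y ?u (int i) w) =
        sc c (X E ((-1 + (- int m) - int i) - int n + 1) (X F (int i) w))"
      using Y_creation_mode[OF mn(2), of E "-1 + (- int m) - int i" "Y ?u (int i) w"] by (auto simp: Y_X)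
    moreover have "X E ((-1 + (- int m) - int i) - int n + 1) (X F (int i) w) \<in> Fil (Suc l) 0"
      using X_create_Fil[OF _ X_annihilate_Fil[OF _ w, of "int i" F], of "(-1 + (- int m) - int i) - int n + 1" E] mn
      by simp
    ultimately show ?thesis by (simp add: subspace_scale)
  qed
  have pos: "Y ?u (- int m - int (Suc i)) (Y ?v (-1 + int (Suc i)) w) \<in> Fil (Suc l) 0" for i
  proof -
    obtain c where c: "Y ?v (int i) w = sc c (X E (int i - int n + 1) w)" "int i < int n - 1 \<Longrightarrow> c = 0"
      using Y_creation_mode[OF mn(2), of E "int i" w] by auto
    \<comment> \<open>For i < n-1 the operator e(i-n+1) would create, but its coefficient is 0.
      Otherwise it annihilates, and only f adds a letter.\<close>
    show ?thesis
    proof (cases "int i < int n - 1")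
      case True
      then show ?thesis using c by (simp add: Y_linear subspace_0)
    next
      case False
      have "X F (- int m - int (Suc i)) (X E (int i - int n + 1) w) \<in> Fil (Suc l) 0"
        using X_create_Fil[OF _ X_annihilate_Fil[OF _ w, of "int i - int n + 1" E], of "- int m - int (Suc i)" F] False
        by simp
      then show ?thesis using c by (simp add: Y_X subspace_scale)
    qed
  qed
  have v: "Y ?v (-1) w = X E (- int n) w"
    using Y_creation_mode[OF mn(2), of E "-1" w] by auto
  have "Y (Y ?u (- int m) ?v) (-1) w - X F (- int m) (X E (- int n) w)
      = (?t 0 - X F (- int m) (X E (- int n) w)) + (\<Sum>i<N. ?t (Suc i))"
    using N[rule_format, of "Suc N"] by (simp only: sum.lessThan_Suc_shift) simp
  moreover have "?t (Suc i) \<in> Fil (Suc l) 0" for i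
    using neg[of "Suc i"] pos[of i]
    by (intro subspace_scale subspace_diff Fil_subspace)
  moreover have "?t 0 - X F (- int m) (X E (- int n) w) \<in> Fil (Suc l) 0"
    using neg[of 0] by (simp add: Y_X v subspace_scale subspace_neg)
  ultimately show ?thesis
    by (simp only: Y_X subspace_add[OF Fil_subspace] subspace_sum[OF Fil_subspace])
qed

section \<open>The kernel of h(0)\<close>

lemma H0_word: "X H 0 (pbw_vec X vac ps) = sc (of_int (2 * charge ps)) (pbw_vec X vac ps)"
proof (induction ps)
  case (Cons p ps)
  then show ?case
    by (cases "fst p") (simp_all add: H_E H_F H0_H scale_left_distrib scale_left_diff_distrib algebra_simps)
qed simp

text \<open>By \<open>H0_word\<close> the PBW basis diagonalizes h(0), so independence forces the
  coefficient of every basis word of nonzero charge in v to vanish.\<close>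

lemma H0_kernel:
  assumes "X H 0 v = 0"
  shows "\<exists>l. v \<in> Fil l 0"
proof -
  let ?B = "pbw_vec X vac ` pbw_monos"
  have inj: "inj_on (pbw_vec X vac) pbw_monos" and ind: "independent ?B" and sp: "span ?B = UNIV"
    using affine_voa by (auto simp: affine_voa_def weyl_module_def)
  obtain T r where T: "finite T" "T \<subseteq> ?B" and v: "v = (\<Sum>b\<in>T. sc (r b) b)"
  proof -
    have "v \<in> span ?B" using sp by simp
    then show thesis using that by (auto simp: span_explicit)
  qed
  obtain Q where Q: "Q \<subseteq> pbw_monos" "T = pbw_vec X vac ` Q" using T by (meson subset_imageE)
  then have injQ: "inj_on (pbw_vec X vac) Q" using inj inj_on_subset by blast
  have finQ: "finite Q" using T Q injQ finite_imageD by blast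
  let ?g = "inv_into Q (pbw_vec X vac)"
  have "X H 0 v = (\<Sum>b\<in>T. sc (r b) (X H 0 b))"
    unfolding v by (simp add: module_hom.sum[OF X_hom])
  also have "\<dots> = (\<Sum>b\<in>T. sc (r b * of_int (2 * charge (?g b))) b)"
  proof (rule sum.cong)
    fix b assume "b \<in> T"
    then have "b = pbw_vec X vac (?g b)" using Q by (simp add: f_inv_into_f)
    then have "X H 0 b = sc (of_int (2 * charge (?g b))) b" using H0_word by metis
    then show "sc (r b) (X H 0 b) = sc (r b * of_int (2 * charge (?g b))) b" by simp
  qed simp
  finally have "(\<Sum>b\<in>T. sc (r b * of_int (2 * charge (?g b))) b) = 0" using assms by simp
  then have z: "r b * of_int (2 * charge (?g b)) = 0" if "b \<in> T" for b
    using independentD[OF ind T(1,2), of "\<lambda>b. r b * of_int (2 * charge (?g b))"] that by simp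
  \<comment> \<open>Inserting 0 keeps the maximum meaningful when v has the empty expansion.\<close>
  define l where "l = Max (insert 0 (length ` Q))"
  have "sc (r b) b \<in> Fil l 0" if "b \<in> T" for b
  proof (cases "r b = 0")
    case True
    then show ?thesis by (simp add: subspace_0)
  next
    case False
    then have "charge (?g b) = 0" using z that by fastforce
    moreover have g: "?g b \<in> Q" "pbw_vec X vac (?g b) = b"
      using that Q by (auto simp: f_inv_into_f inv_into_into)
    moreover have "length (?g b) \<le> l" unfolding l_def using finQ g by (intro Max_ge) auto
    moreover have "\<forall>p\<in>set (?g b). snd p \<ge> 1" using g Q by (auto simp: pbw_monos_def)
    ultimately show ?thesis using Fil_word[of "?g b" l] by (simp add: subspace_scale)
  qed
  then have "v \<in> Fil l 0" unfolding v by (rule subspace_sum[OF Fil_subspace])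
  then show ?thesis ..
qed

section \<open>Quadratic vectors f(-m)e(-n)1 in the generated subalgebra\<close>

definition gens :: "'v set" where
  "gens = {vac, X H (-1) vac, X F (-2) (X E (-1) vac)}"

abbreviation U :: "'v set" where "U \<equiv> vgen sc Y gens"

lemma U_subspace [simp]: "subspace U"
  by (simp add: subspace_def vgen.zero vgen.add vgen.scale)

lemma vac_U [simp]: "vac \<in> U"
  by (rule vgen.base) (simp add: gens_def)

lemma W_U: "X F (-2) (X E (-1) vac) \<in> U"
  by (rule vgen.base) (simp add: gens_def)

lemma X_H_U: "v \<in> U \<Longrightarrow> X H n v \<in> U"
  using vgen.prod[of "X H (-1) vac" sc Y gens v n] by (simp add: Y_X vgen.base gens_def)

lemma D_U: "v \<in> U \<Longrightarrow> D v \<in> U"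
  by (simp add: vgen.prod)

text \<open>Three reductions modulo \<open>U\<close> bring every term to a multiple of
  \<open>x\<close>: an h-mode moved to the front of a vector of \<open>U\<close> stays in
  \<open>U\<close>; e and f commute on the vacuum up to h(j)1; and applying D to f(-m)e(-1)1 gives
  f(-m)e(-2)1 = -m \<open>x\<close>.\<close>

lemma W_1_mod_U:
  assumes m: "m \<ge> 1" and IH: "\<And>a. 1 \<le> a \<Longrightarrow> a \<le> m \<Longrightarrow> X F (- int a) (X E (-1) vac) \<in> U"
  defines "x \<equiv> X F (- int m - 1) (X E (-1) vac)"
  shows "Y (X F (-2) (X E (-1) vac)) 1 (X F (- int m) (X E (-1) vac))
     - sc (((k + 1) * of_nat m + 1) * (of_nat m + 2)) x \<in> U"
proof -
  let ?w = "X F (- int m) (X E (-1) vac)"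
  \<comment> \<open>The iterate formula for \<open>W\<^sub>1\<close> is \<open>\<Sum>i. (i + 1) (f i - e i)\<close>; below, \<open>s i\<close> and \<open>- t i\<close> are the
    coefficients of \<open>x\<close> in \<open>f i\<close> and \<open>e i\<close> modulo \<open>U\<close>.\<close>
  define f where "f i = X F (-2 - int i) (X E (1 + int i) ?w)" for i
  define e where "e i = X E (-1 - int i) (X F (int i) ?w)" for i
  define s where "s i = (if i + 1 < m then 2 else if i + 1 = m then 2 + of_nat m * k else 0 :: complex)" for i
  define t where "t i = (if i = 0 then 2 * of_nat m + 2 else if i = 1 then of_nat m * k else 0 :: complex)" for i :: nat
  have D1: "X F (- int m) (X E (-2) vac) + sc (of_nat m) x \<in> U"
    using D_U[OF IH[of m]] m by (simp add: D_X Y_vac x_def add.commute)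
  have EF: "X E (- int a) (X F (- int b) vac) - X F (- int b) (X E (- int a) vac) \<in> U" if "a \<ge> 1" "b \<ge> 1" for a b
    using that X_H_U[OF vac_U, of "- int a + - int b"] by (simp add: E_F)
  have fi: "f i - sc (s i) x \<in> U" for i
  proof -
    consider "i + 1 < m" | "i + 1 = m" | "i + 1 > m" by linarith
    then show ?thesis
    proof cases
      \<comment> \<open>Since i + 2 \<le> m, the hypothesis covers f(-i-2)e(-1)1. Moving h(i+1-m) in
        front of f(-i-2) produces the 2 \<open>x\<close>.\<close>
      case 1
      have "1 + int i - int m + (-2 - int i) = - int m - 1" "- int (i + 2) = -2 - int i"
        by simp_all
      then have "X H (1 + int i - int m) (X F (- int (i + 2)) (X E (-1) vac))
          = X F (-2 - int i) (X H (1 + int i - int m) (X E (-1) vac)) - sc 2 x"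
        using H_F[of "1 + int i - int m" "-2 - int i" "X E (-1) vac"] by (simp only: x_def)
      moreover have "f i = X F (-2 - int i) (X H (1 + int i - int m) (X E (-1) vac))
          + X F (-2 - int i) (X F (- int m) (X E (-1) (X E (1 + int i) vac)))"
        using 1 by (simp add: f_def E_F E_E[of _ "-1"])
      ultimately have "X H (1 + int i - int m) (X F (- int (i + 2)) (X E (-1) vac)) = f i - sc (s i) x"
        using 1 by (simp add: s_def)
      moreover have "X H (1 + int i - int m) (X F (- int (i + 2)) (X E (-1) vac)) \<in> U"
        using 1 by (intro X_H_U IH) auto
      ultimately show ?thesis by simp
    next
      case 2
      have *: "1 + int i = int m" "-2 - int i = - int m - 1" using 2 by auto
      \<comment> \<open>Here [e(m), f(-m)] = h(0) + mk, and h(0) has eigenvalue 2 on e(-1)1.\<close>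
      have "f i = sc (s i) x"
        unfolding f_def * using 2 by (simp add: s_def x_def E_F E_E H_E scale_left_distrib)
      then show ?thesis by (simp add: subspace_0)
    next
      case 3
      then have "f i = 0"
        by (simp add: f_def E_F E_E[of _ "-1"] H_E)
      then show ?thesis using 3 by (simp add: s_def subspace_0)
    qed
  qed
  have neg_Suc: "- int (m + 1) = - int m - 1" by simp
  have F_E: "X F p (X E (-1) vac) = - X H (p - 1) vac + sc (if p = 1 then k else 0) vac" if "p \<ge> 0" for p
    using E_F[of "-1" p vac] that by (auto simp: algebra_simps)
  have ei: "e i + sc (t i) x \<in> U" for i
  proof -
    consider "i = 0" | "i = 1" | "i \<ge> 2" by linarith
    then show ?thesis
    proof cases
      \<comment> \<open>Now f(0)e(-1)1 = -h(-1)1. Pulling h(-1) to the front past f(-m) and e(-1)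
        leaves two commutator terms, worth -2 \<open>x\<close> and -2m \<open>x\<close> modulo
        \<open>U\<close>.\<close>
      case 1
      let ?EF = "\<lambda>a b. X E (- int a) (X F (- int b) vac)"
      have "X F (- int m) (X H (-1) vac) = X H (-1) (X F (- int m) vac) + sc 2 (X F (- int (m + 1)) vac)"
        by (simp add: H_F algebra_simps)
      moreover have "X E (-1) (X H (-1) v) = X H (-1) (X E (-1) v) - sc 2 (X E (-2) v)" for v
        by (simp add: H_E)
      ultimately have "e i = - X H (-1) (?EF 1 m) + sc 2 (?EF 2 m) - sc 2 (?EF 1 (m + 1))"
        using 1 by (simp add: e_def F_F[of 0] F_E)
      then have "e i + sc (t i) x = - X H (-1) (?EF 1 m) + sc 2 (?EF 2 m - X F (- int m) (X E (-2) vac))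
          + sc 2 (X F (- int m) (X E (-2) vac) + sc (of_nat m) x) - sc 2 (?EF 1 (m + 1) - x)"
        using 1 by (simp add: t_def scale_right_diff_distrib scale_right_distrib scale_left_distrib)
      moreover have "?EF 1 m \<in> U"
        using subspace_add[OF U_subspace EF[of 1 m] IH[of m]] m by simp
      moreover have "?EF 2 m - X F (- int m) (X E (-2) vac) \<in> U" "?EF 1 (m + 1) - x \<in> U"
        using EF[of 2 m] EF[of 1 "m + 1"] m unfolding x_def neg_Suc by simp_all
      ultimately show ?thesis
        using D1 by (simp only: vgen.add vgen.scale subspace_diff[OF U_subspace] subspace_neg[OF U_subspace] X_H_U)
    next
      case 2
      have "e i + sc (t i) x = sc k (X E (- int 2) (X F (- int m) vac) - X F (- int m) (X E (- int 2) vac))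
          + sc k (X F (- int m) (X E (-2) vac) + sc (of_nat m) x)"
        using 2 by (simp add: e_def t_def F_F[of 1] F_E scale_right_diff_distrib scale_right_distrib mult.commute)
      then show ?thesis
        using vgen.add[OF vgen.scale[OF EF[of 2 m]] vgen.scale[OF D1]] m by simp
    next
      case 3
      then have "e i = 0" by (simp add: e_def F_F[of "int i"] F_E)
      then show ?thesis using 3 by (simp add: t_def subspace_0)
    qed
  qed
  obtain N where N: "\<forall>M\<ge>N. Y (Y (X F (-1) vac) (-2) (X E (-1) vac)) 1 ?w = (\<Sum>i<M. sc ((-1) ^ i * (of_int (-2) gchoose i))
             (Y (X F (-1) vac) (-2 - int i) (Y (X E (-1) vac) (1 + int i) ?w)
              - sc ((-1) powi (-2)) (Y (X E (-1) vac) (1 + (-2) - int i) (Y (X F (-1) vac) (int i) ?w))))"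
    using iterate_formula by blast
  \<comment> \<open>Beyond \<open>N\<close>, the range must cover the supports of \<open>s\<close>
    (i < m) and of \<open>t\<close> (i < 2).\<close>
  define M where "M = N + m + 2"
  have "Y (X F (-2) (X E (-1) vac)) 1 ?w = (\<Sum>i<M. sc (of_nat (Suc i)) (f i - e i))"
    using N[rule_format, of M] gchoose_minus_two by (simp add: Y_X f_def e_def M_def)
  moreover have "(\<Sum>i<M. sc (of_nat (Suc i)) (f i - e i)) - sc (\<Sum>i<M. of_nat (Suc i) * (s i + t i)) x
      = (\<Sum>i<M. sc (of_nat (Suc i)) ((f i - sc (s i) x) - (e i + sc (t i) x)))"
    unfolding scale_sum_left sum_subtractf[symmetric]
    by (rule sum.cong[OF refl]) (simp add: algebra_simps del: of_nat_Suc)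
  moreover have "\<dots> \<in> U"
    by (intro subspace_sum vgen.scale subspace_diff[OF U_subspace fi ei] U_subspace)
  moreover have "(\<Sum>i<M. of_nat (Suc i) * (s i + t i)) = ((k + 1) * of_nat m + 1) * (of_nat m + 2)"
  proof -
    have "(\<Sum>i<M. of_nat (Suc i) * s i) = (\<Sum>i<m. of_nat (Suc i) * s i)"
      by (rule sum.mono_neutral_right) (auto simp: M_def s_def)
    also obtain p where p: "m = Suc p" using m by (cases m) auto
    have "(\<Sum>i<m. of_nat (Suc i) * s i) = (\<Sum>i<p. of_nat (Suc i) * 2) + of_nat m * (2 + of_nat m * k)"
      by (simp add: p s_def)
    also have "(\<Sum>i<p. of_nat (Suc i) * 2 :: complex) = of_nat p * of_nat (Suc p)"
      by (induction p) (simp_all add: algebra_simps)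
    finally have s: "(\<Sum>i<M. of_nat (Suc i) * s i) = of_nat m * (of_nat m - 1) + of_nat m * (2 + of_nat m * k)"
      by (simp add: p algebra_simps)
    have "(\<Sum>i<M. of_nat (Suc i) * t i) = (\<Sum>i<2. of_nat (Suc i) * t i)"
      by (rule sum.mono_neutral_right) (auto simp: M_def t_def)
    also have "\<dots> = 2 * of_nat m + 2 + 2 * of_nat m * k"
      by (simp add: t_def numeral_2_eq_2)
    finally have t: "(\<Sum>i<M. of_nat (Suc i) * t i) = 2 * of_nat m + 2 + 2 * of_nat m * k" .
    have "(\<Sum>i<M. of_nat (Suc i) * (s i + t i)) = (\<Sum>i<M. of_nat (Suc i) * s i) + (\<Sum>i<M. of_nat (Suc i) * t i)"
      by (simp only: distrib_left sum.distrib)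
    also have "\<dots> = ((k + 1) * of_nat m + 1) * (of_nat m + 2)"
      unfolding s t by (simp add: algebra_simps)
    finally show ?thesis .
  qed
  ultimately show ?thesis by simp
qed

lemma F_E_one_U:
  assumes k: "Re k \<ge> 0" and "m \<ge> 1"
  shows "X F (- int m) (X E (-1) vac) \<in> U"
  using assms(2)
proof (induction m rule: less_induct)
  case (less m)
  show ?case
  proof (cases "m = 1")
    case True
    \<comment> \<open>h(1) kills e(-1)1, so only [h(1), f(-2)] = -2 f(-1) contributes.\<close>
    have "sc (-1/2) (X H 1 (X F (-2) (X E (-1) vac))) \<in> U"
      by (intro vgen.scale X_H_U W_U)
    then show ?thesis using True by (simp add: H_F H_E)
  next
    case False
    define l where "l = m - 1"
    have l: "l \<ge> 1" "m = Suc l" using less False by (auto simp: l_def)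
    let ?x = "X F (- int l - 1) (X E (-1) vac)"
    define c where "c = ((k + 1) * of_nat l + 1) * (of_nat l + 2)"
    have IH: "X F (- int a) (X E (-1) vac) \<in> U" if "1 \<le> a" "a \<le> l" for a
      using that l less by simp
    let ?y = "Y (X F (-2) (X E (-1) vac)) 1 (X F (- int l) (X E (-1) vac))"
    have "?y \<in> U" using IH[of l] l(1) by (intro vgen.prod W_U) simp
    moreover have "?y - sc c ?x \<in> U" using W_1_mod_U[OF l(1) IH] by (simp add: c_def)
    ultimately have "?y - (?y - sc c ?x) \<in> U" by (rule subspace_diff[OF U_subspace])
    then have "sc c ?x \<in> U" by simp
    then have "sc (1 / c) (sc c ?x) \<in> U" by (rule vgen.scale)
    \<comment> \<open>Both factors have positive real part; this is where Re k \<ge> 0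
      enters.\<close>
    moreover have "c \<noteq> 0"
    proof -
      have "Re ((k + 1) * of_nat l + 1) > 0" using k by (simp add: add_nonneg_pos)
      moreover have "Re (of_nat l + 2) > 0" by simp
      ultimately show ?thesis unfolding c_def by (metis less_irrefl mult_eq_0_iff zero_complex.simps(1))
    qed
    moreover have "- int m = - int l - 1" using l by simp
    ultimately show ?thesis by simp
  qed
qed

text \<open>D sends f(-m)e(-n)1 to m f(-m-1)e(-n)1 + n f(-m)e(-n-1)1. Solving for the last vector
  raises n, provided the induction keeps m arbitrary.\<close>

lemma F_E_U:
  assumes k: "Re k \<ge> 0" and "m \<ge> 1" "n \<ge> 1"
  shows "X F (- int m) (X E (- int n) vac) \<in> U"
  using assms(3,2)
proof (induction n arbitrary: m rule: dec_induct)
  case base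
  then show ?case using F_E_one_U[OF k] by simp
next
  case (step n)
  have neg_Suc: "- int (Suc a) = - int a - 1" for a by simp
  have "sc (1 / of_nat n) (D (X F (- int m) (X E (- int n) vac)) - sc (of_nat m) (X F (- int m - 1) (X E (- int n) vac))) \<in> U"
    using step.IH[of m] step.IH[of "Suc m", unfolded neg_Suc] step.prems
    by (intro vgen.scale subspace_diff D_U U_subspace) simp_all
  then show ?case unfolding neg_Suc using step(1) by (simp add: D_X Y_vac)
qed

section \<open>Charge-zero words and the conclusion\<close>

lemma Fil_zero_charge_U:
  assumes k: "Re k \<ge> 0"
  shows "Fil l 0 \<subseteq> U"
proof (induction l rule: less_induct)
  case (less l)
  have "pbw_vec X vac ps \<in> U" if ps: "\<forall>p\<in>set ps. snd p \<ge> 1" "length ps \<le> l" "charge ps = 0" for ps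
  proof (cases rule: charge_zero_cases[OF ps(3)])
    case 1
    then show ?thesis by (induction ps) (auto simp: X_H_U)
  next
    case (2 m n)
    define qs where "qs = remove1 (F, m) ps"
    define rs where "rs = remove1 (E, n) qs"
    have En: "(E, n) \<in> set qs" using 2 by (simp add: qs_def)
    have mn: "m \<ge> 1" "n \<ge> 1" using 2 ps by auto
    have len: "length ps = Suc (length qs)" "length qs = Suc (length rs)"
      using length_pos_if_in_set[OF 2(1)] length_pos_if_in_set[OF En] 2(1) En
      by (simp_all add: qs_def rs_def length_remove1 del: in_set_remove1)
    have pos: "\<forall>p\<in>set qs. snd p \<ge> 1" "\<forall>p\<in>set rs. snd p \<ge> 1"
      using ps(1) by (auto simp: qs_def rs_def dest!: notin_set_remove1)
    have ch: "charge qs = 1" "charge rs = 0"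
      using 2 En ps(3) by (simp_all add: qs_def rs_def charge_remove1)
    let ?w = "pbw_vec X vac rs"
    have w: "?w \<in> Fil (length rs) 0" using Fil_word[OF pos(2)] ch by simp
    have sub: "Fil (Suc (length rs)) 0 \<subseteq> U" and sub': "Fil (length rs) 0 \<subseteq> U"
      using len ps(2) by (auto intro!: less.IH)
    \<comment> \<open>The word is compared in turn with f(-m) \<open>qs\<close>, with f(-m)e(-n)
      \<open>rs\<close>, and with the product of f(-m)e(-n)1 and \<open>rs\<close>. Each error lies
      in \<open>Fil\<close> of length at most \<open>Suc (length rs)\<close>, which is below l, and
      the last product is in \<open>U\<close> by induction.\<close>
    have 1: "pbw_vec X vac ps - X F (- int m) (pbw_vec X vac qs) \<in> U"
      using word_move_front[OF ps(1) 2(1)] sub len ps(3) by (auto simp: qs_def)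
    have "pbw_vec X vac qs - X E (- int n) ?w \<in> Fil (length rs) 1"
      using word_move_front[OF pos(1) En] len ch by (simp add: rs_def)
    from X_create_Fil[OF _ this, of "- int m" F]
    have 2: "X F (- int m) (pbw_vec X vac qs) - X F (- int m) (X E (- int n) ?w) \<in> U"
      using sub mn by auto
    have 3: "Y (X F (- int m) (X E (- int n) vac)) (-1) ?w - X F (- int m) (X E (- int n) ?w) \<in> U"
      using quadratic_leading_term[OF mn w] sub by auto
    have 4: "Y (X F (- int m) (X E (- int n) vac)) (-1) ?w \<in> U"
      using F_E_U[OF k mn] w sub' by (auto intro: vgen.prod)
    show ?thesis
      using subspace_add[OF U_subspace subspace_add[OF U_subspace 1 2] subspace_diff[OF U_subspace 4 3]] by simp
  qed
  then show ?case unfolding Fil_def by (intro span_minimal) auto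
qed

lemma U_eq_H0_kernel:
  assumes k: "Re k \<ge> 0"
  shows "U = {v. X H 0 v = 0}"
proof (intro equalityI subsetI CollectI)
  fix v assume "v \<in> {v. X H 0 v = 0}"
  then show "v \<in> U" using H0_kernel Fil_zero_charge_U[OF k] by blast
next
  fix v assume "v \<in> U"
  \<comment> \<open>The generators have charge zero, and the derivation property carries the kernel
    through products.\<close>
  then show "X H 0 v = 0"
    by induction (auto simp: gens_def H0_derivation Y_zero_left Y_linear H_E H_F H0_H)
qed

end

theorem theorem2p1:
  fixes sc :: "complex \<Rightarrow> 'v::ab_group_add \<Rightarrow> 'v"
    and k :: int
    and X :: "sl2b \<Rightarrow> int \<Rightarrow> 'v \<Rightarrow> 'v"
    and vac :: 'v
    and Y :: "'v \<Rightarrow> int \<Rightarrow> 'v \<Rightarrow> 'v"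
  assumes "k \<ge> 2"
    and "affine_voa sc (of_int k) X vac Y"
  shows "module.subspace sc {v. X H 0 v = 0}
      \<and> vac \<in> {v. X H 0 v = 0}
      \<and> omega_aff sc (of_int k) X vac \<in> {v. X H 0 v = 0}
      \<and> (\<forall>u\<in>{v. X H 0 v = 0}. \<forall>w\<in>{v. X H 0 v = 0}. \<forall>n. Y u n w \<in> {v. X H 0 v = 0})
      \<and> vgen sc Y {vac, X H (-1) vac, X F (-2) (X E (-1) vac)} = {v. X H 0 v = 0}"
proof -
  interpret affine_vertex_algebra sc "of_int k" X vac Y
    using assms(2) by unfold_locales
  have "vgen sc Y {vac, X H (-1) vac, X F (-2) (X E (-1) vac)} = {v. X H 0 v = 0}"
    using U_eq_H0_kernel assms(1) by (simp add: gens_def)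
  moreover have "X H 0 (omega_aff sc (of_int k) X vac) = 0"
    by (simp add: omega_aff_def H_E H_F H0_H)
  ultimately show ?thesis
    by (auto simp: subspace_def H0_derivation Y_zero_left Y_linear)
qed

end
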